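(* Consider the augmented $N$-reel system with states $s=(w_1,\dots,w_N,x)$. Let $\pi(R)$ be the random policy and let $\pi(I)$ be the index policy, which in state $(w_1,\dots,w_N,x)$ assigns the component to a reel $$n^*(w_1,\dots,w_N,x)\in\operatorname*{arg\,min}_{n\in\{1,\dots,N\}}\Big\{c(w_n,x)+h_1(e(w_n,x))-h_1(w_n)\Big\}.$$ Then the index policy yields no more waste than the random policy, $$g^{\pi(I)}\le g^{\pi(R)},$$ where $g^{\pi}$ denotes the long-run average cost of policy $\pi$. Moreover, $\pi(I)$ is obtained by one step of policy iteration on $\pi(R)$: for every state $(w_1,\dots,w_N,x)$, the reel $n^*(w_1,\dots,w_N,x)$ minimizes over $n\in\{1,\dots,N\}$ the quantity $$c(w_n,x)+\sum_{x'}p(x')\,\hat h_N^{\pi(R)}(w_1,\dots,e(w_n,x),\dots,w_N,x'),$$ where $\hat h_N^{\pi(R)}$ is the bias function of the augmented system under $\pi(R)$.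
   Context: Let $B$ and $N$ be positive integers ($B$ is the weight of a new reel, $N$ the number of reels), $\mathbf W=\{0,1,\dots,B-1\}$ the set of reel weights and $\mathbf X=\{1,\dots,B\}$ the set of component weights. Component weights are i.i.d. with a probability mass function $p$ on $\mathbf X$. For $w\in\mathbf W$, $x\in\mathbf X$ put $e(w,x)=w-x$ if $w\ge x$ and $e(w,x)=B-x$ otherwise (reel weight after assigning a component of weight $x$); $c(w,x)=0$ if $w\ge x$ and $c(w,x)=w$ otherwise (discarded weight, the one-step cost). Augmented $N$-reel system: a Markov decision process with state space $\mathcal S=\mathbf W^N\times\mathbf X$. In state $(w_1,\dots,w_N,x)$ a reel $n\in\{1,\dots,N\}$ is chosen, cost $c(w_n,x)$ is incurred, and the next state is $(w_1,\dots,e(w_n,x),\dots,w_N,x')$ (only the $n$-th reel weight is replaced), where $x'\sim p$ is drawn independently. The long-run average cost of a stationary policy $\pi$ is $g^\pi=\lim_{T\to\infty}\frac1T\sum_{t=1}^T\mathbb E[\text{cost incurred in period }t]$. Standing assumption: under the policies considered, the limiting transition probabilities do not depend on the initial state, so that $g^\pi$ is a scalar independent of the initial state. The random policy $\pi(R)$ chooses each reel with probability $1/N$, independently of everything else. Its bias function $\hat h_N^{\pi(R)}$ satisfies, with $\hat g_N^{\pi(R)}=g^{\pi(R)}$, $$\hat h_N^{\pi(R)}(w_1,\dots,w_N,x)=-\hat g_N^{\pi(R)}+\frac1N\sum_{n=1}^N\Big[c(w_n,x)+\sum_{x'}p(x')\,\hat h_N^{\pi(R)}(w_1,\dots,e(w_n,x),\dots,w_N,x')\Big].$$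 The pair $(g_1,h_1)$ is any solution of the single-reel Bellman equation $$h_1(w)=-g_1+\sum_{x'}p(x')\big(c(w,x')+h_1(e(w,x'))\big)\qquad\text{for all }w\in\mathbf W.$$ Sums over $x'$ run over $\mathbf X$. *)

theory Defs
  imports "HOL-Probability.Probability"
begin

definition next_weight :: "nat \<Rightarrow> nat \<Rightarrow> nat \<Rightarrow> nat" where
  "next_weight B w x = (if w \<ge> x then w - x else B - x)"

definition waste :: "nat \<Rightarrow> nat \<Rightarrow> nat" where
  "waste w x = (if w \<ge> x then 0 else w)"

definition reel_weights :: "nat \<Rightarrow> nat set" where
  "reel_weights B = {0..<B}"

definition component_weights :: "nat \<Rightarrow> nat set" where
  "component_weights B = {1..B}"

type_synonym state = "(nat \<Rightarrow> nat) \<times> nat"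

text \<open>Reels are numbered from 1 to N. A vector of reel weights is an extensional function on the
  set of reel numbers, so that the state space is a finite set.\<close>

definition states :: "nat \<Rightarrow> nat \<Rightarrow> state set" where
  "states B N = ({1..N} \<rightarrow>\<^sub>E reel_weights B) \<times> component_weights B"

definition assign :: "nat \<Rightarrow> (nat \<Rightarrow> nat) \<Rightarrow> nat \<Rightarrow> nat \<Rightarrow> (nat \<Rightarrow> nat)" where
  "assign B w n x = w(n := next_weight B (w n) x)"

text \<open>A stationary (possibly randomized) policy maps a state to a distribution over reel numbers.\<close>

type_synonym policy = "state \<Rightarrow> nat pmf"

definition transition :: "nat \<Rightarrow> nat pmf \<Rightarrow> policy \<Rightarrow> state \<Rightarrow> state pmf" where
  "transition B p \<pi> s =
     bind_pmf (\<pi> s) (\<lambda>n. map_pmf (\<lambda>x'. (assign B (fst s) n (snd s), x')) p)"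

primrec state_dist :: "nat \<Rightarrow> nat pmf \<Rightarrow> policy \<Rightarrow> state \<Rightarrow> nat \<Rightarrow> state pmf" where
  "state_dist B p \<pi> s 0 = return_pmf s"
| "state_dist B p \<pi> s (Suc t) = bind_pmf (state_dist B p \<pi> s t) (transition B p \<pi>)"

definition policy_cost :: "policy \<Rightarrow> state \<Rightarrow> real" where
  "policy_cost \<pi> s = measure_pmf.expectation (\<pi> s) (\<lambda>n. real (waste (fst s n) (snd s)))"

text \<open>The first period is the one in which the system is in its initial state, so the cost of
  period t + 1 is incurred after t transitions.\<close>

definition expected_cost :: "nat \<Rightarrow> nat pmf \<Rightarrow> policy \<Rightarrow> state \<Rightarrow> nat \<Rightarrow> real" where
  "expected_cost B p \<pi> s t = measure_pmf.expectation (state_dist B p \<pi> s t) (policy_cost \<pi>)"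

definition has_average_cost :: "nat \<Rightarrow> nat \<Rightarrow> nat pmf \<Rightarrow> policy \<Rightarrow> real \<Rightarrow> bool" where
  "has_average_cost B N p \<pi> g \<longleftrightarrow>
     (\<forall>s\<in>states B N. (\<lambda>T. (\<Sum>t<T. expected_cost B p \<pi> s t) / real T) \<longlonglongrightarrow> g)"

definition average_cost :: "nat \<Rightarrow> nat \<Rightarrow> nat pmf \<Rightarrow> policy \<Rightarrow> real" where
  "average_cost B N p \<pi> = (THE g. has_average_cost B N p \<pi> g)"

text \<open>The limiting transition probabilities do not depend on the initial state. The limit is
  taken in the Cesaro sense, so that periodic chains are covered; whenever the ordinary limits
  exist, they agree with the Cesaro limits.\<close>

definition limiting_probs_independent :: "nat \<Rightarrow> nat \<Rightarrow> nat pmf \<Rightarrow> policy \<Rightarrow> bool" where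
  "limiting_probs_independent B N p \<pi> \<longleftrightarrow>
     (\<exists>\<mu>. \<forall>s\<in>states B N. \<forall>s'\<in>states B N.
        (\<lambda>T. (\<Sum>t<T. pmf (state_dist B p \<pi> s t) s') / real T) \<longlonglongrightarrow> \<mu> s')"

definition random_policy :: "nat \<Rightarrow> policy" where
  "random_policy N s = pmf_of_set {1..N}"

definition index_policy :: "(state \<Rightarrow> nat) \<Rightarrow> policy" where
  "index_policy nstar s = return_pmf (nstar s)"

definition single_reel_bellman :: "nat \<Rightarrow> nat pmf \<Rightarrow> real \<Rightarrow> (nat \<Rightarrow> real) \<Rightarrow> bool" where
  "single_reel_bellman B p g1 h1 \<longleftrightarrow>
     (\<forall>w\<in>reel_weights B. h1 w = - g1
        + (\<Sum>x'\<in>component_weights B. pmf p x' * (real (waste w x') + h1 (next_weight B w x'))))"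

definition is_index_rule :: "nat \<Rightarrow> nat \<Rightarrow> (nat \<Rightarrow> real) \<Rightarrow> (state \<Rightarrow> nat) \<Rightarrow> bool" where
  "is_index_rule B N h1 nstar \<longleftrightarrow>
     (\<forall>(w, x)\<in>states B N.
        is_arg_min (\<lambda>n. real (waste (w n) x) + h1 (next_weight B (w n) x) - h1 (w n))
          (\<lambda>n. n \<in> {1..N}) (nstar (w, x)))"

definition action_value ::
  "nat \<Rightarrow> nat pmf \<Rightarrow> (state \<Rightarrow> real) \<Rightarrow> (nat \<Rightarrow> nat) \<Rightarrow> nat \<Rightarrow> nat \<Rightarrow> real" where
  "action_value B p h w x n =
     real (waste (w n) x) + (\<Sum>x'\<in>component_weights B. pmf p x' * h (assign B w n x, x'))"

text \<open>Under the independence assumption for the random policy, this equation determines the bias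
  function up to an additive constant; every solution is admitted.\<close>

definition is_random_policy_bias :: "nat \<Rightarrow> nat \<Rightarrow> nat pmf \<Rightarrow> (state \<Rightarrow> real) \<Rightarrow> bool" where
  "is_random_policy_bias B N p h \<longleftrightarrow>
     (\<forall>(w, x)\<in>states B N.
        h (w, x) = - average_cost B N p (random_policy N)
          + (1 / real N) * (\<Sum>n\<in>{1..N}. action_value B p h w x n))"

text \<open>Under the independence assumption the long-run average cost exists and is the same for all
  initial states, so the description in the definition of average cost denotes it.\<close>

lemma finite_states: "finite (states B N)"
  by (auto simp: states_def reel_weights_def component_weights_def intro!: finite_PiE)

lemma states_nonempty: "B > 0 \<Longrightarrow> states B N \<noteq> {}"
  by (auto simp: states_def reel_weights_def component_weights_def PiE_eq_empty_iff)

lemma set_state_dist: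
  assumes "set_pmf p \<subseteq> component_weights B"
    and "\<And>s. s \<in> states B N \<Longrightarrow> set_pmf (\<pi> s) \<subseteq> {1..N}"
    and "s \<in> states B N"
  shows "set_pmf (state_dist B p \<pi> s t) \<subseteq> states B N"
proof (induction t)
  case 0
  then show ?case using assms(3) by simp
next
  case (Suc t)
  have "(assign B w n x, x') \<in> states B N"
    if "(w, x) \<in> states B N" "n \<in> {1..N}" "x' \<in> component_weights B" for w n x x'
  proof -
    have w: "w \<in> {1..N} \<rightarrow>\<^sub>E reel_weights B" and x: "x \<in> {1..B}"
      using that(1) by (auto simp: states_def component_weights_def)
    have "w n \<in> reel_weights B" using w that(2) by blast
    then have "next_weight B (w n) x \<in> reel_weights B" using x
      by (auto simp: next_weight_def reel_weights_def)
    then have "assign B w n x \<in> {1..N} \<rightarrow>\<^sub>E reel_weights B"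
      using w that(2) unfolding assign_def by (auto simp: PiE_iff extensional_def)
    then show ?thesis using that(3) by (simp add: states_def)
  qed
  then have "set_pmf (transition B p \<pi> s') \<subseteq> states B N" if "s' \<in> states B N" for s'
    using assms(1) assms(2)[OF that] that by (cases s') (fastforce simp: transition_def)
  then show ?case using Suc by auto
qed

lemma has_average_cost_average_cost:
  assumes "B > 0" and "set_pmf p \<subseteq> component_weights B"
    and "\<And>s. s \<in> states B N \<Longrightarrow> set_pmf (\<pi> s) \<subseteq> {1..N}"
    and "limiting_probs_independent B N p \<pi>"
  shows "has_average_cost B N p \<pi> (average_cost B N p \<pi>)"
proof -
  obtain \<mu> where \<mu>: "\<And>s s'. s \<in> states B N \<Longrightarrow> s' \<in> states B N \<Longrightarrow>
      (\<lambda>T. (\<Sum>t<T. pmf (state_dist B p \<pi> s t) s') / real T) \<longlonglongrightarrow> \<mu> s'"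
    using assms(4) unfolding limiting_probs_independent_def by blast
  define g where "g = (\<Sum>s'\<in>states B N. \<mu> s' * policy_cost \<pi> s')"
  have "(\<lambda>T. (\<Sum>t<T. expected_cost B p \<pi> s t) / real T) \<longlonglongrightarrow> g" if s: "s \<in> states B N" for s
  proof -
    have sub: "set_pmf (state_dist B p \<pi> s t) \<subseteq> states B N" for t
      using assms(2,3) s by (rule set_state_dist)
    have E: "expected_cost B p \<pi> s t =
        (\<Sum>s'\<in>states B N. pmf (state_dist B p \<pi> s t) s' * policy_cost \<pi> s')" for t
      unfolding expected_cost_def
      using sub[of t] finite_states[of B N]
      by (subst integral_measure_pmf_real[where A = "states B N"]) (auto simp: mult.commute)
    have "(\<Sum>t<T. expected_cost B p \<pi> s t) / real T =
        (\<Sum>s'\<in>states B N. (\<Sum>t<T. pmf (state_dist B p \<pi> s t) s') / real T * policy_cost \<pi> s')" for T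
      unfolding E by (subst sum.swap) (simp add: sum_divide_distrib sum_distrib_right)
    then show ?thesis
      unfolding g_def by (simp only:) (intro tendsto_sum tendsto_mult \<mu> s tendsto_const)
  qed
  then have g: "has_average_cost B N p \<pi> g"
    by (simp add: has_average_cost_def)
  moreover have "g' = g" if "has_average_cost B N p \<pi> g'" for g'
    using states_nonempty[OF assms(1), of N] that g LIMSEQ_unique
    unfolding has_average_cost_def by blast
  ultimately show ?thesis
    unfolding average_cost_def by (rule theI)
qed

end

theory Submission
  imports Defs
begin

text \<open>The random policy uses each reel a fraction \<open>1/N\<close> of the time, at moments that do not depend
  on the weights. Its bias therefore separates over the reels: up to an additive constant it is
  \<open>\<Sum>m. h1 (w m)\<close> plus the mean over all reels of the index
  \<open>c (w n, x) + h1 (e (w n, x)) - h1 (w n)\<close>. The single-reel Bellman equation says precisely that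
  the \<open>p\<close>-mean of the index over the component weight is \<open>g1\<close>, so after averaging over the next
  component only \<open>\<Sum>m. h1 (w m) + g1\<close> remains of this function. The value of using reel \<open>n\<close> is
  then the index of reel \<open>n\<close> plus a term independent of \<open>n\<close> (\<open>action_value_separable_bias\<close>), and
  minimizing the index is the same as improving on the random policy.

  Averaging that identity over \<open>n\<close> gives the evaluation equation of the random policy with
  constant \<open>g1\<close>, and minimizing over \<open>n\<close> gives an inequality for the index policy with the same
  constant. Both are turned into statements on long-run averages by telescoping along the chain
  (\<open>average_le_of_drift\<close>): the random policy costs exactly \<open>g1\<close>, the index policy at most \<open>g1\<close>.

  The conclusion on policy improvement concerns every solution of the bias equation. Two solutions
  differ by a function that is harmonic for the chain of the random policy. Such a function equals
  its own time averages, and these have a limit that does not depend on the initial state, so it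
  is constant (\<open>harmonic_imp_constant\<close>) and does not affect the minimizers.\<close>

section \<open>The controlled chain on its finite state space\<close>

definition admissible :: "nat \<Rightarrow> nat \<Rightarrow> policy \<Rightarrow> bool" where
  "admissible B N \<pi> \<longleftrightarrow> (\<forall>s\<in>states B N. set_pmf (\<pi> s) \<subseteq> {1..N})"

lemma next_weight_in_reel_weights:
  assumes "w \<in> reel_weights B" "x \<in> component_weights B"
  shows "next_weight B w x \<in> reel_weights B"
  using assms by (auto simp: next_weight_def reel_weights_def component_weights_def)

lemma assign_in_states:
  assumes "(w, x) \<in> states B N" "n \<in> {1..N}" "x' \<in> component_weights B"
  shows "(assign B w n x, x') \<in> states B N"
proof -
  have w: "w \<in> {1..N} \<rightarrow>\<^sub>E reel_weights B" and x: "x \<in> component_weights B"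
    using assms(1) by (auto simp: states_def)
  have "next_weight B (w n) x \<in> reel_weights B"
    using w x assms(2) by (intro next_weight_in_reel_weights) auto
  then have "assign B w n x \<in> {1..N} \<rightarrow>\<^sub>E reel_weights B"
    using w assms(2) unfolding assign_def by (auto simp: PiE_iff extensional_def)
  then show ?thesis using assms(3) by (simp add: states_def)
qed

lemma set_transition:
  assumes "set_pmf p \<subseteq> component_weights B" "admissible B N \<pi>" "s \<in> states B N"
  shows "set_pmf (transition B p \<pi> s) \<subseteq> states B N"
  using assms assign_in_states
  by (cases s) (fastforce simp: transition_def admissible_def)

lemma set_state_dist_admissible:
  assumes "set_pmf p \<subseteq> component_weights B" "admissible B N \<pi>" "s \<in> states B N"
  shows "set_pmf (state_dist B p \<pi> s t) \<subseteq> states B N"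
  using assms by (intro set_state_dist) (auto simp: admissible_def)

lemma expectation_eq_sum:
  fixes f :: "'a \<Rightarrow> real"
  assumes "finite A" "set_pmf q \<subseteq> A"
  shows "measure_pmf.expectation q f = (\<Sum>a\<in>A. pmf q a * f a)"
  using assms by (subst integral_measure_pmf_real[where A = A]) (auto simp: mult.commute)

lemma expectation_mono_finite:
  fixes f g :: "'a \<Rightarrow> real"
  assumes "finite A" "set_pmf q \<subseteq> A" "\<And>a. a \<in> A \<Longrightarrow> f a \<le> g a"
  shows "measure_pmf.expectation q f \<le> measure_pmf.expectation q g"
  unfolding expectation_eq_sum[OF assms(1,2)]
  using assms(3) by (intro sum_mono mult_left_mono) auto

lemma expectation_component:
  fixes f :: "nat \<Rightarrow> real"
  assumes "set_pmf p \<subseteq> component_weights B"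
  shows "measure_pmf.expectation p f = (\<Sum>x\<in>component_weights B. pmf p x * f x)"
  using assms by (intro expectation_eq_sum) (auto simp: component_weights_def)

lemma sum_pmf_component:
  assumes "set_pmf p \<subseteq> component_weights B"
  shows "(\<Sum>x\<in>component_weights B. pmf p x) = 1"
  using assms by (intro sum_pmf_eq_1) (auto simp: component_weights_def)

lemma expectation_state_dist_Suc:
  fixes f :: "state \<Rightarrow> real"
  assumes "set_pmf p \<subseteq> component_weights B" "admissible B N \<pi>" "s \<in> states B N"
  shows "measure_pmf.expectation (state_dist B p \<pi> s (Suc t)) f =
    measure_pmf.expectation (state_dist B p \<pi> s t)
      (\<lambda>s'. measure_pmf.expectation (transition B p \<pi> s') f)"
proof -
  have sub: "set_pmf (state_dist B p \<pi> s t) \<subseteq> states B N"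
    using assms by (rule set_state_dist_admissible)
  have "finite (set_pmf (transition B p \<pi> s'))" if "s' \<in> states B N" for s'
    using set_transition[OF assms(1,2) that] finite_states finite_subset by blast
  then show ?thesis
    using sub finite_states[of B N]
    by (simp add: pmf_expectation_bind[where A = "states B N"]
        expectation_eq_sum[where A = "states B N"])
qed

text \<open>A one-step lookahead under any policy is an average of action values; this connects the
  Markov chain with the policy-improvement quantity.\<close>

lemma one_step_lookahead:
  assumes "set_pmf p \<subseteq> component_weights B" "admissible B N \<pi>" "(w, x) \<in> states B N"
  shows "policy_cost \<pi> (w, x) + measure_pmf.expectation (transition B p \<pi> (w, x)) h
    = measure_pmf.expectation (\<pi> (w, x)) (action_value B p h w x)"
proof -
  have sub: "set_pmf (\<pi> (w, x)) \<subseteq> {1..N}"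
    using assms(2,3) by (auto simp: admissible_def)
  have fin: "finite (set_pmf p)"
    using assms(1) finite_subset by (fastforce simp: component_weights_def)
  have "measure_pmf.expectation (transition B p \<pi> (w, x)) h =
      (\<Sum>n\<in>{1..N}. pmf (\<pi> (w, x)) n *
        (\<Sum>x'\<in>component_weights B. pmf p x' * h (assign B w n x, x')))"
    unfolding transition_def using sub fin
    by (subst pmf_expectation_bind[where A = "{1..N}"])
      (auto simp: expectation_component[OF assms(1)])
  then show ?thesis
    unfolding policy_cost_def action_value_def
    by (simp add: expectation_eq_sum[OF _ sub] sum.distrib distrib_left)
qed

section \<open>Long-run averages along the chain\<close>

text \<open>In each step, whatever \<open>f\<close> exceeds \<open>g\<close> is paid for by an expected decrease of the potential
  \<open>h\<close>. Summed over time these decreases telescope, and since \<open>h\<close> is bounded on the finite state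
  space their contribution to the average vanishes.\<close>

lemma average_le_of_drift:
  fixes f h :: "state \<Rightarrow> real"
  assumes p: "set_pmf p \<subseteq> component_weights B" and \<pi>: "admissible B N \<pi>"
    and s: "s \<in> states B N"
    and drift: "\<And>s'. s' \<in> states B N \<Longrightarrow>
      f s' + measure_pmf.expectation (transition B p \<pi> s') h \<le> g + h s'"
    and lim: "(\<lambda>T. (\<Sum>t<T. measure_pmf.expectation (state_dist B p \<pi> s t) f) / real T)
      \<longlonglongrightarrow> L"
  shows "L \<le> g"
proof -
  let ?E = "\<lambda>t. measure_pmf.expectation (state_dist B p \<pi> s t)"
  note sub = set_state_dist_admissible[OF p \<pi> s]
  note E = expectation_eq_sum[OF finite_states sub]
  have one: "(\<Sum>s'\<in>states B N. pmf (state_dist B p \<pi> s t) s') = 1" for t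
    using sub finite_states by (intro sum_pmf_eq_1) auto
  have step: "?E t f + ?E (Suc t) h \<le> g + ?E t h" for t
  proof -
    have "?E t f + ?E (Suc t) h =
        ?E t (\<lambda>s'. f s' + measure_pmf.expectation (transition B p \<pi> s') h)"
      unfolding expectation_state_dist_Suc[OF p \<pi> s] unfolding E
      by (simp add: sum.distrib distrib_left)
    also have "\<dots> \<le> ?E t (\<lambda>s'. g + h s')"
      using drift by (intro expectation_mono_finite[OF finite_states sub]) auto
    also have "\<dots> = g + ?E t h"
      unfolding E by (simp add: sum.distrib distrib_left one flip: sum_distrib_right)
    finally show ?thesis .
  qed
  have telescope: "(\<Sum>t<T. ?E t f) \<le> real T * g + (h s - ?E T h)" for T
  proof (induction T)
    case (Suc T)
    then show ?case using step[of T] by (simp add: algebra_simps del: state_dist.simps)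
  qed simp
  define C where "C = (\<Sum>s'\<in>states B N. \<bar>h s'\<bar>)"
  have "- ?E T h \<le> C" for T
  proof -
    have "- ?E T h = (\<Sum>s'\<in>states B N. pmf (state_dist B p \<pi> s T) s' * (- h s'))"
      unfolding E by (simp add: sum_negf)
    also have "\<dots> \<le> (\<Sum>s'\<in>states B N. 1 * \<bar>h s'\<bar>)"
    proof (rule sum_mono)
      fix s'
      have "pmf (state_dist B p \<pi> s T) s' * (- h s') \<le> pmf (state_dist B p \<pi> s T) s' * \<bar>h s'\<bar>"
        by (intro mult_left_mono) auto
      also have "\<dots> \<le> 1 * \<bar>h s'\<bar>"
        by (intro mult_right_mono pmf_le_1) auto
      finally show "pmf (state_dist B p \<pi> s T) s' * (- h s') \<le> 1 * \<bar>h s'\<bar>" .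
    qed
    finally show ?thesis by (simp add: C_def)
  qed
  then have "(\<Sum>t<T. ?E t f) / real T \<le> g + (h s + C) / real T" if "T > 0" for T
    using telescope[of T] that by (simp add: field_simps) (smt (verit))
  then have bound: "\<forall>\<^sub>F T in sequentially. (\<Sum>t<T. ?E t f) / real T \<le> g + (h s + C) / real T"
    by (intro eventually_mono[OF eventually_gt_at_top[of 0]])
  have "(\<lambda>T. g + (h s + C) / real T) \<longlonglongrightarrow> g + 0"
    by (intro tendsto_add tendsto_const lim_const_over_n)
  then show "L \<le> g"
    using tendsto_le[OF _ _ lim bound] by simp
qed

text \<open>A harmonic function equals each of its time averages, and in the limit these forget the
  initial state.\<close>

lemma harmonic_imp_constant:
  fixes d :: "state \<Rightarrow> real"
  assumes p: "set_pmf p \<subseteq> component_weights B" and \<pi>: "admissible B N \<pi>"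
    and indep: "limiting_probs_independent B N p \<pi>"
    and harmonic: "\<And>s. s \<in> states B N \<Longrightarrow> measure_pmf.expectation (transition B p \<pi> s) d = d s"
  obtains k where "\<And>s. s \<in> states B N \<Longrightarrow> d s = k"
proof -
  obtain \<mu> where \<mu>: "\<And>s s'. s \<in> states B N \<Longrightarrow> s' \<in> states B N \<Longrightarrow>
      (\<lambda>T. (\<Sum>t<T. pmf (state_dist B p \<pi> s t) s') / real T) \<longlonglongrightarrow> \<mu> s'"
    using indep unfolding limiting_probs_independent_def by blast
  have "d s = (\<Sum>s'\<in>states B N. \<mu> s' * d s')" if s: "s \<in> states B N" for s
  proof -
    note E = expectation_eq_sum[OF finite_states set_state_dist_admissible[OF p \<pi> s]]
    have const: "measure_pmf.expectation (state_dist B p \<pi> s t) d = d s" for t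
    proof (induction t)
      case (Suc t)
      have "measure_pmf.expectation (state_dist B p \<pi> s (Suc t)) d
          = measure_pmf.expectation (state_dist B p \<pi> s t) d"
        unfolding expectation_state_dist_Suc[OF p \<pi> s] unfolding E by (simp add: harmonic)
      then show ?case using Suc by simp
    qed simp
    have "(\<Sum>s'\<in>states B N. (\<Sum>t<T. pmf (state_dist B p \<pi> s t) s') / real T * d s')
        = (\<Sum>t<T. measure_pmf.expectation (state_dist B p \<pi> s t) d) / real T" for T
      unfolding E by (subst sum.swap) (simp add: sum_divide_distrib sum_distrib_right)
    then have "(\<Sum>s'\<in>states B N. (\<Sum>t<T. pmf (state_dist B p \<pi> s t) s') / real T * d s') = d s"
      if "T > 0" for T
      using that by (simp add: const)
    then have "(\<lambda>T. \<Sum>s'\<in>states B N. (\<Sum>t<T. pmf (state_dist B p \<pi> s t) s') / real T * d s')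
        \<longlonglongrightarrow> d s"
      by (intro tendsto_eventually eventually_mono[OF eventually_gt_at_top[of 0]])
    moreover have "(\<lambda>T. \<Sum>s'\<in>states B N. (\<Sum>t<T. pmf (state_dist B p \<pi> s t) s') / real T * d s')
        \<longlonglongrightarrow> (\<Sum>s'\<in>states B N. \<mu> s' * d s')"
      by (intro tendsto_sum tendsto_mult \<mu> s tendsto_const)
    ultimately show ?thesis by (rule LIMSEQ_unique)
  qed
  then show ?thesis by (rule that)
qed

lemma average_cost_le:
  assumes "B > 0" and p: "set_pmf p \<subseteq> component_weights B" and \<pi>: "admissible B N \<pi>"
    and "limiting_probs_independent B N p \<pi>"
    and drift: "\<And>w x. (w, x) \<in> states B N \<Longrightarrow>
      measure_pmf.expectation (\<pi> (w, x)) (action_value B p h w x) \<le> g + h (w, x)"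
  shows "average_cost B N p \<pi> \<le> g"
proof -
  obtain s where s: "s \<in> states B N" using states_nonempty[OF assms(1)] by blast
  have "has_average_cost B N p \<pi> (average_cost B N p \<pi>)"
    using assms(1-4) by (intro has_average_cost_average_cost) (auto simp: admissible_def)
  then have lim: "(\<lambda>T. (\<Sum>t<T. measure_pmf.expectation (state_dist B p \<pi> s t) (policy_cost \<pi>))
      / real T) \<longlonglongrightarrow> average_cost B N p \<pi>"
    using s by (simp add: has_average_cost_def expected_cost_def)
  show ?thesis
  proof (rule average_le_of_drift[OF p \<pi> s _ lim])
    fix s' assume "s' \<in> states B N"
    then show "policy_cost \<pi> s' + measure_pmf.expectation (transition B p \<pi> s') h \<le> g + h s'"
      using drift one_step_lookahead[OF p \<pi>] by (cases s') simp
  qed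
qed

text \<open>The drift bound applied to the negated cost and the negated potential turns an inequality in
  the other direction into a lower bound.\<close>

lemma average_cost_ge:
  assumes "B > 0" and p: "set_pmf p \<subseteq> component_weights B" and \<pi>: "admissible B N \<pi>"
    and "limiting_probs_independent B N p \<pi>"
    and drift: "\<And>w x. (w, x) \<in> states B N \<Longrightarrow>
      g + h (w, x) \<le> measure_pmf.expectation (\<pi> (w, x)) (action_value B p h w x)"
  shows "g \<le> average_cost B N p \<pi>"
proof -
  obtain s where s: "s \<in> states B N" using states_nonempty[OF assms(1)] by blast
  have "has_average_cost B N p \<pi> (average_cost B N p \<pi>)"
    using assms(1-4) by (intro has_average_cost_average_cost) (auto simp: admissible_def)
  then have "(\<lambda>T. - ((\<Sum>t<T. measure_pmf.expectation (state_dist B p \<pi> s t) (policy_cost \<pi>))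
      / real T)) \<longlonglongrightarrow> - average_cost B N p \<pi>"
    using s by (intro tendsto_minus) (simp add: has_average_cost_def expected_cost_def)
  then have lim: "(\<lambda>T. (\<Sum>t<T. measure_pmf.expectation (state_dist B p \<pi> s t)
      (\<lambda>s'. - policy_cost \<pi> s')) / real T) \<longlonglongrightarrow> - average_cost B N p \<pi>"
    by (simp add: sum_negf)
  have "- average_cost B N p \<pi> \<le> - g"
  proof (rule average_le_of_drift[OF p \<pi> s _ lim])
    fix s' assume "s' \<in> states B N"
    then show "- policy_cost \<pi> s' + measure_pmf.expectation (transition B p \<pi> s') (\<lambda>s. - h s)
        \<le> - g + - h s'"
      using drift[of "fst s'" "snd s'"] one_step_lookahead[OF p \<pi>, of "fst s'" "snd s'" h] by simp
  qed
  then show ?thesis by simp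
qed

section \<open>The separable bias of the random policy\<close>

definition reel_index :: "nat \<Rightarrow> (nat \<Rightarrow> real) \<Rightarrow> nat \<Rightarrow> nat \<Rightarrow> real" where
  "reel_index B h1 w x = real (waste w x) + h1 (next_weight B w x) - h1 w"

text \<open>The first sum is the potential of the reels before the assignment; the second term corrects
  it for the component that is already known.\<close>

definition separable_bias :: "nat \<Rightarrow> nat \<Rightarrow> (nat \<Rightarrow> real) \<Rightarrow> state \<Rightarrow> real" where
  "separable_bias B N h1 s =
     (\<Sum>m\<in>{1..N}. h1 (fst s m)) + (1 / real N) * (\<Sum>n\<in>{1..N}. reel_index B h1 (fst s n) (snd s))"

lemma mean_reel_index:
  assumes p: "set_pmf p \<subseteq> component_weights B" and "single_reel_bellman B p g1 h1"
    and "w \<in> reel_weights B"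
  shows "(\<Sum>x\<in>component_weights B. pmf p x * reel_index B h1 w x) = g1"
proof -
  have "(\<Sum>x\<in>component_weights B. pmf p x * reel_index B h1 w x) =
      (\<Sum>x\<in>component_weights B. pmf p x * (real (waste w x) + h1 (next_weight B w x)))
      - (\<Sum>x\<in>component_weights B. pmf p x) * h1 w"
    unfolding reel_index_def
    by (simp add: right_diff_distrib sum_subtractf sum_distrib_right)
  also have "\<dots> = g1"
    using assms(2,3) by (simp add: single_reel_bellman_def sum_pmf_component[OF p])
  finally show ?thesis .
qed

lemma mean_separable_bias:
  assumes "N > 0" and p: "set_pmf p \<subseteq> component_weights B" and "single_reel_bellman B p g1 h1"
    and w: "\<And>n. n \<in> {1..N} \<Longrightarrow> w n \<in> reel_weights B"
  shows "(\<Sum>x\<in>component_weights B. pmf p x * separable_bias B N h1 (w, x))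
    = (\<Sum>m\<in>{1..N}. h1 (w m)) + g1"
proof -
  define S where "S = (\<Sum>m\<in>{1..N}. h1 (w m))"
  have pointwise: "pmf p x * separable_bias B N h1 (w, x) =
      pmf p x * S + (1 / real N) * (\<Sum>n\<in>{1..N}. pmf p x * reel_index B h1 (w n) x)" for x
    by (simp add: separable_bias_def S_def distrib_left flip: sum_distrib_left)
  have "(\<Sum>x\<in>component_weights B. pmf p x * separable_bias B N h1 (w, x)) =
      (\<Sum>x\<in>component_weights B. pmf p x * S) + (1 / real N) *
      (\<Sum>x\<in>component_weights B. \<Sum>n\<in>{1..N}. pmf p x * reel_index B h1 (w n) x)"
    by (simp only: pointwise sum.distrib sum_distrib_left)
  also have "(\<Sum>x\<in>component_weights B. pmf p x * S) = S"
    by (simp add: sum_pmf_component[OF p] flip: sum_distrib_right)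
  also have "(\<Sum>x\<in>component_weights B. \<Sum>n\<in>{1..N}. pmf p x * reel_index B h1 (w n) x)
      = (\<Sum>n\<in>{1..N}. g1)"
    using mean_reel_index[OF assms(2,3) w] by (subst sum.swap) simp
  finally show ?thesis using assms(1) by (simp add: S_def)
qed

text \<open>Using reel \<open>n\<close> changes only the \<open>n\<close>-th summand of the potential, and its cost together with
  that change is the index of the reel.\<close>

lemma action_value_separable_bias:
  assumes "N > 0" "set_pmf p \<subseteq> component_weights B" "single_reel_bellman B p g1 h1"
    and st: "(w, x) \<in> states B N" and n: "n \<in> {1..N}"
  shows "action_value B p (separable_bias B N h1) w x n
    = reel_index B h1 (w n) x + (\<Sum>m\<in>{1..N}. h1 (w m)) + g1"
proof -
  have "assign B w n x m \<in> reel_weights B" if "m \<in> {1..N}" for m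
    using assign_in_states[OF st n, of x] st that by (auto simp: states_def)
  then have "action_value B p (separable_bias B N h1) w x n
      = real (waste (w n) x) + (\<Sum>m\<in>{1..N}. h1 (assign B w n x m)) + g1"
    unfolding action_value_def using mean_separable_bias[OF assms(1-3)] by simp
  moreover have "(\<Sum>m\<in>{1..N}. h1 (assign B w n x m))
      = h1 (next_weight B (w n) x) + (\<Sum>m\<in>{1..N} - {n}. h1 (w m))"
    using n by (subst sum.remove[of _ n]) (auto simp: assign_def intro!: sum.cong)
  moreover have "(\<Sum>m\<in>{1..N}. h1 (w m)) = h1 (w n) + (\<Sum>m\<in>{1..N} - {n}. h1 (w m))"
    using n by (subst sum.remove[of _ n]) auto
  ultimately show ?thesis by (simp add: reel_index_def)
qed

lemma mean_action_value_separable_bias: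
  assumes "N > 0" "set_pmf p \<subseteq> component_weights B" "single_reel_bellman B p g1 h1"
    and "(w, x) \<in> states B N"
  shows "(1 / real N) * (\<Sum>n\<in>{1..N}. action_value B p (separable_bias B N h1) w x n)
    = g1 + separable_bias B N h1 (w, x)"
proof -
  have "(\<Sum>n\<in>{1..N}. action_value B p (separable_bias B N h1) w x n)
      = (\<Sum>n\<in>{1..N}. reel_index B h1 (w n) x) + real N * ((\<Sum>m\<in>{1..N}. h1 (w m)) + g1)"
    using action_value_separable_bias[OF assms] by (simp add: sum.distrib algebra_simps)
  then show ?thesis using assms(1) by (simp add: separable_bias_def field_simps)
qed

lemma expectation_random_policy:
  fixes f :: "nat \<Rightarrow> real"
  assumes "N > 0"
  shows "measure_pmf.expectation (random_policy N s) f = (1 / real N) * (\<Sum>n\<in>{1..N}. f n)"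
  using assms by (simp add: random_policy_def integral_pmf_of_set)

lemma admissible_random_policy: "N > 0 \<Longrightarrow> admissible B N (random_policy N)"
  by (auto simp: admissible_def random_policy_def)

lemma average_cost_random_policy:
  assumes "B > 0" "N > 0" "set_pmf p \<subseteq> component_weights B" "single_reel_bellman B p g1 h1"
    and "limiting_probs_independent B N p (random_policy N)"
  shows "average_cost B N p (random_policy N) = g1"
proof (rule antisym)
  note eval = mean_action_value_separable_bias[OF assms(2-4)]
  note adm = admissible_random_policy[OF assms(2)]
  show "average_cost B N p (random_policy N) \<le> g1"
    by (rule average_cost_le[OF assms(1,3) adm assms(5), where h = "separable_bias B N h1"])
      (simp only: expectation_random_policy[OF assms(2)] eval order_refl)
  show "g1 \<le> average_cost B N p (random_policy N)"
    by (rule average_cost_ge[OF assms(1,3) adm assms(5), where h = "separable_bias B N h1"])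
      (simp only: expectation_random_policy[OF assms(2)] eval order_refl)
qed

lemma action_value_diff:
  "action_value B p h w x n - action_value B p h' w x n
    = (\<Sum>x'\<in>component_weights B. pmf p x' * (h (assign B w n x, x') - h' (assign B w n x, x')))"
  by (simp add: action_value_def right_diff_distrib sum_subtractf)

text \<open>The difference of two biases is harmonic, because the costs and the constants in their
  equations agree.\<close>

lemma random_policy_bias_unique:
  assumes "B > 0" "N > 0" "set_pmf p \<subseteq> component_weights B" "single_reel_bellman B p g1 h1"
    and "limiting_probs_independent B N p (random_policy N)"
    and bias: "is_random_policy_bias B N p h"
  obtains k where "\<And>s. s \<in> states B N \<Longrightarrow> h s - separable_bias B N h1 s = k"
proof (rule harmonic_imp_constant[OF assms(3) admissible_random_policy[OF assms(2)] assms(5)])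
  let ?H = "separable_bias B N h1" and ?\<pi> = "random_policy N"
  note adm = admissible_random_policy[OF assms(2)]
  fix s assume s: "s \<in> states B N"
  obtain w x where wx: "s = (w, x)" by (cases s)
  note look = one_step_lookahead[OF assms(3) adm s[unfolded wx],
      unfolded expectation_random_policy[OF assms(2)]]
  have fin: "finite (set_pmf (transition B p ?\<pi> s))"
    using set_transition[OF assms(3) adm s] finite_states finite_subset by blast
  have "measure_pmf.expectation (transition B p ?\<pi> s) (\<lambda>s. h s - ?H s)
      = measure_pmf.expectation (transition B p ?\<pi> s) h
      - measure_pmf.expectation (transition B p ?\<pi> s) ?H"
    using fin by (intro Bochner_Integration.integral_diff integrable_measure_pmf_finite)
  also have "\<dots> = (1 / real N) * (\<Sum>n\<in>{1..N}. action_value B p h w x n)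
      - (1 / real N) * (\<Sum>n\<in>{1..N}. action_value B p ?H w x n)"
    using look[of h] look[of ?H] unfolding wx by linarith
  also have "(1 / real N) * (\<Sum>n\<in>{1..N}. action_value B p ?H w x n) = g1 + ?H s"
    using mean_action_value_separable_bias[OF assms(2-4)] s by (simp add: wx)
  also have "(1 / real N) * (\<Sum>n\<in>{1..N}. action_value B p h w x n) = g1 + h s"
    using bias s average_cost_random_policy[OF assms(1-5)]
    unfolding is_random_policy_bias_def wx by fastforce
  finally show "measure_pmf.expectation (transition B p ?\<pi> s) (\<lambda>s. h s - ?H s) = h s - ?H s"
    by simp
qed (rule that)

section \<open>Comparison of the index policy with the random policy\<close>

lemma index_rule_minimizes:
  assumes "is_index_rule B N h1 nstar" "(w, x) \<in> states B N"
  shows "nstar (w, x) \<in> {1..N}"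
    and "\<And>n. n \<in> {1..N} \<Longrightarrow> reel_index B h1 (w (nstar (w, x))) x \<le> reel_index B h1 (w n) x"
  using assms by (fastforce simp: is_index_rule_def is_arg_min_linorder reel_index_def)+

theorem theorem4p6:
  fixes B N :: nat
    and p :: "nat pmf"
    and g1 :: real
    and h1 :: "nat \<Rightarrow> real"
    and nstar :: "state \<Rightarrow> nat"
  assumes "B > 0" and "N > 0"
    and "set_pmf p \<subseteq> component_weights B"
    and "single_reel_bellman B p g1 h1"
    and "is_index_rule B N h1 nstar"
    and "limiting_probs_independent B N p (random_policy N)"
    and "limiting_probs_independent B N p (index_policy nstar)"
  shows "average_cost B N p (index_policy nstar) \<le> average_cost B N p (random_policy N)
    \<and> (\<forall>h. is_random_policy_bias B N p h \<longrightarrow>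
         (\<forall>(w, x)\<in>states B N.
            is_arg_min (action_value B p h w x) (\<lambda>n. n \<in> {1..N}) (nstar (w, x))))"
proof
  let ?H = "separable_bias B N h1"
  note index = index_rule_minimizes[OF assms(5)]
  have best: "action_value B p ?H w x (nstar (w, x)) \<le> action_value B p ?H w x n"
    if "(w, x) \<in> states B N" "n \<in> {1..N}" for w x n
    using action_value_separable_bias[OF assms(2-4)] index that by simp
  have adm: "admissible B N (index_policy nstar)"
    using index(1) by (auto simp: admissible_def index_policy_def)
  have "average_cost B N p (index_policy nstar) \<le> g1"
  proof (rule average_cost_le[OF assms(1,3) adm assms(7)])
    fix w x assume st: "(w, x) \<in> states B N"
    \<comment> \<open>the minimum over the reels is at most the mean over the reels\<close>
    have "real N * action_value B p ?H w x (nstar (w, x))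
        \<le> (\<Sum>n\<in>{1..N}. action_value B p ?H w x n)"
      using sum_bounded_below[of "{1..N}" _ "action_value B p ?H w x"] best[OF st] by simp
    then have "action_value B p ?H w x (nstar (w, x))
        \<le> (1 / real N) * (\<Sum>n\<in>{1..N}. action_value B p ?H w x n)"
      using assms(2) by (simp add: field_simps)
    then show "measure_pmf.expectation (index_policy nstar (w, x)) (action_value B p ?H w x)
        \<le> g1 + ?H (w, x)"
      using mean_action_value_separable_bias[OF assms(2-4) st] by (simp add: index_policy_def)
  qed
  then show "average_cost B N p (index_policy nstar) \<le> average_cost B N p (random_policy N)"
    using average_cost_random_policy[OF assms(1-4,6)] by simp

  show "\<forall>h. is_random_policy_bias B N p h \<longrightarrow>
      (\<forall>(w, x)\<in>states B N.
        is_arg_min (action_value B p h w x) (\<lambda>n. n \<in> {1..N}) (nstar (w, x)))"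
  proof (intro allI impI ballI, clarify)
    fix h w x
    assume bias: "is_random_policy_bias B N p h" and st: "(w, x) \<in> states B N"
    obtain k where k: "\<And>s. s \<in> states B N \<Longrightarrow> h s - ?H s = k"
      using random_policy_bias_unique[OF assms(1-4,6) bias] by blast
    have shift: "action_value B p h w x n = action_value B p ?H w x n + k" if "n \<in> {1..N}" for n
    proof -
      have "action_value B p h w x n - action_value B p ?H w x n
          = (\<Sum>x'\<in>component_weights B. pmf p x' * k)"
        unfolding action_value_diff using assign_in_states[OF st that] k
        by (intro sum.cong) auto
      also have "\<dots> = k"
        by (simp add: sum_pmf_component[OF assms(3)] flip: sum_distrib_right)
      finally show ?thesis by simp
    qed
    show "is_arg_min (action_value B p h w x) (\<lambda>n. n \<in> {1..N}) (nstar (w, x))"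
      using index(1)[OF st] best[OF st] by (simp add: is_arg_min_linorder shift)
  qed
qed

end
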